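(* Let $S:\mathbb{A}\to\mathbb{A}$ be a continuous solution of the Gołąb–Schinzel equation $S(x+S(x)y)=S(x)S(y)$ (for $x,y\in\mathbb{G}_S^*$) that is Fréchet differentiable at the points of $\mathbb{G}_S$, and let $\gamma=S'(0):\mathbb{A}\to\mathbb{A}$ be its (continuous linear) Fréchet derivative at $0$. Put $\mathcal{N}_\gamma=\{x\in\mathbb{A}:\gamma(x)=0\}$ and $\mathcal{N}=\{a\in\mathbb{A}:S(a)=1_{\mathbb{A}}\}$. Then there exist two functions $m,n:\mathbb{G}_S\to\mathcal{N}_\gamma$ such that for all $x\in\mathbb{G}_S$ $$S(x)=1_{\mathbb{A}}+\gamma(x)+n(x)=1_{\mathbb{A}}+\gamma(1_{\mathbb{A}})x+m(x),$$ where: (i) $n(x)$ is both orthogonal and $\gamma$-orthogonal to $\gamma(x)$, and $n(x)=o(x)$ as $x\to0$; (ii) $m(x)$ is orthogonal to $\gamma(x)$, and $\gamma$-orthogonal both to $\gamma(x)$ and to $\gamma(1_{\mathbb{A}})x$. In particular, $S(\mathcal{N})\subseteq\{y:\gamma(y-1_{\mathbb{A}})=0\}=1_{\mathbb{A}}+\mathcal{N}_\gamma$; and if $\gamma$ is injective then $S(x)=1_{\mathbb{A}}+\gamma(1_{\mathbb{A}})x$ for all $x\in\mathbb{G}_S$.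
   Context: $\mathbb{A}$ is a unital commutative real Banach algebra with identity $1_{\mathbb{A}}$; "linear" means $\mathbb{R}$-linear. $\mathbb{A}^{-1}$ is the open set of invertible elements and $\mathbb{A}_1$ is the connected component of $1_{\mathbb{A}}$ in $\mathbb{A}^{-1}$. For $S:\mathbb{A}\to\mathbb{A}$, $\mathbb{G}_S^*=\{x:S(x)\in\mathbb{A}^{-1}\}$ and $\mathbb{G}_S=\{x:S(x)\in\mathbb{A}_1\}$. Standing assumptions: $0,1_{\mathbb{A}}\in\mathbb{G}_S^*$ (so $S(0)=1_{\mathbb{A}}$). Orthogonality: the two bilinear forms generated by $\gamma$ are $\langle a,b\rangle=\gamma(ab)$ and $\langle a,b\rangle_\gamma=\gamma(a\,\gamma(b))$ (with values in $\mathbb{A}$; the second is in fact symmetric in this setting). "$a$ is orthogonal to $b$" means $\langle a,b\rangle=0$; "$a$ is $\gamma$-orthogonal to $b$" means $\langle a,b\rangle_\gamma=0$. *)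

theory Defs
  imports "HOL-Analysis.Analysis" "HOL-Library.Landau_Symbols"
begin

(* A unital commutative real Banach algebra is a type of sort
   {real_normed_algebra, banach, comm_ring_1}. The class real_normed_algebra_1 is
   avoided on purpose: it would also impose the normalisation norm 1 = 1. *)

definition invertibles :: "'a::comm_monoid_mult set"
  where "invertibles = {x. x dvd 1}"

definition invertibles_1 :: "'a::{topological_space, comm_monoid_mult} set"
  where "invertibles_1 = connected_component_set invertibles 1"

definition G_star :: "('a \<Rightarrow> 'a::comm_monoid_mult) \<Rightarrow> 'a set"
  where "G_star S = {x. S x \<in> invertibles}"

definition G_one :: "('a \<Rightarrow> 'a::{topological_space, comm_monoid_mult}) \<Rightarrow> 'a set"
  where "G_one S = {x. S x \<in> invertibles_1}"

definition golab_schinzel :: "('a \<Rightarrow> 'a::comm_ring_1) \<Rightarrow> bool"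
  where "golab_schinzel S \<longleftrightarrow>
    (\<forall>x\<in>G_star S. \<forall>y\<in>G_star S. S (x + S x * y) = S x * S y)"

definition null_space :: "('a \<Rightarrow> 'a::comm_ring_1) \<Rightarrow> 'a set"
  where "null_space \<gamma> = {x. \<gamma> x = 0}"

definition one_set :: "('a \<Rightarrow> 'a::comm_ring_1) \<Rightarrow> 'a set"
  where "one_set S = {a. S a = 1}"

(* Both forms generated by \<gamma> take values in the algebra itself. *)

definition form :: "('a \<Rightarrow> 'a::comm_ring_1) \<Rightarrow> 'a \<Rightarrow> 'a \<Rightarrow> 'a"
  where "form \<gamma> a b = \<gamma> (a * b)"

definition gform :: "('a \<Rightarrow> 'a::comm_ring_1) \<Rightarrow> 'a \<Rightarrow> 'a \<Rightarrow> 'a"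
  where "gform \<gamma> a b = \<gamma> (a * \<gamma> b)"

definition form_orthogonal :: "('a \<Rightarrow> 'a::comm_ring_1) \<Rightarrow> 'a \<Rightarrow> 'a \<Rightarrow> bool"
  where "form_orthogonal \<gamma> a b \<longleftrightarrow> form \<gamma> a b = 0"

definition gform_orthogonal :: "('a \<Rightarrow> 'a::comm_ring_1) \<Rightarrow> 'a \<Rightarrow> 'a \<Rightarrow> bool"
  where "gform_orthogonal \<gamma> a b \<longleftrightarrow> gform \<gamma> a b = 0"

end

theory Submission
  imports Defs
begin

text \<open>
  Write \<open>v\<close> for the inverse of \<open>S y\<close>. Differentiating the equation in each of its two variables at \<open>0\<close>
  and eliminating \<open>S' y\<close> gives \<open>\<gamma> (v * (h + \<gamma> h * y)) = \<gamma> h\<close> for all \<open>h\<close>; its first-order part at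
  \<open>y = 0\<close> is the symmetry \<open>\<gamma> (a * \<gamma> b) = \<gamma> (b * \<gamma> a)\<close>. By symmetry \<open>v = 1 - \<gamma> (y * v)\<close> modulo the ideal
  \<open>I = {a. \<forall>h. \<gamma> (h * a) = 0}\<close>, which \<open>\<gamma>\<close> annihilates. For small \<open>y\<close> this may be applied to the inverse
  \<open>- y * v\<close> of \<open>y\<close> under \<open>x \<circ> y = x + S x * y\<close>, so that \<open>S = 1 + \<gamma>\<close> modulo \<open>I\<close> near \<open>0\<close>. Inserting this into
  the equation shows \<open>\<gamma> (\<gamma> x * z) = \<gamma> x * \<gamma> z\<close> modulo \<open>I\<close> for all \<open>x\<close>, \<open>z\<close>. For an arbitrary point \<open>x\<close>
  and the inverse \<open>v\<close> of \<open>S x\<close> it follows that, modulo \<open>I\<close>, \<open>\<gamma> (v * x) = v * \<gamma> x\<close>, so \<open>v = 1 - v * \<gamma> x\<close>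
  and hence \<open>S x = 1 + \<gamma> x\<close>; no connectedness of the domain is needed.
\<close>

text \<open>The library's geometric series needs \<open>norm 1 = 1\<close>, which is not available here.\<close>

lemma dvd_one_if_norm_less_1:
  fixes x :: "'a::{real_normed_algebra, banach, comm_ring_1}"
  assumes "norm (1 - x) < 1"
  shows "x dvd 1"
proof -
  define d where "d = 1 - x"
  have bound: "norm (d ^ Suc n) \<le> norm d ^ Suc n" for n
  proof (induction n)
    case (Suc n)
    have "norm (d ^ Suc (Suc n)) \<le> norm d * norm (d ^ Suc n)"
      using norm_mult_ineq[of d "d ^ Suc n"] by simp
    also have "\<dots> \<le> norm d * norm d ^ Suc n"
      by (intro mult_left_mono Suc) simp
    finally show ?case by simp
  qed simp
  have "summable (\<lambda>n. norm d ^ Suc n)"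
    unfolding summable_Suc_iff using assms by (simp add: d_def)
  then have "summable (\<lambda>n. d ^ Suc n)"
    by (rule summable_comparison_test'[where N = 0]) (use bound in auto)
  then have sm: "summable (\<lambda>n. d ^ n)"
    by (subst (asm) summable_Suc_iff)
  have "(\<Sum>n. d ^ n) = 1 + (\<Sum>n. d ^ Suc n)"
    using suminf_split_head[OF sm] by simp
  also have "(\<Sum>n. d ^ Suc n) = d * (\<Sum>n. d ^ n)"
    using suminf_mult[OF sm, of d] by simp
  finally have "1 = x * (\<Sum>n. d ^ n)"
    by (simp add: d_def algebra_simps)
  then show ?thesis by (rule dvdI)
qed

lemma ball_subset_invertibles_1:
  "ball (1 :: 'a::{real_normed_algebra, banach, comm_ring_1}) 1 \<subseteq> invertibles_1"
  unfolding invertibles_1_def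
  by (rule connected_component_maximal)
    (auto simp: invertibles_def dist_norm intro: dvd_one_if_norm_less_1)

lemma invertibles_1_subset: "invertibles_1 \<subseteq> invertibles"
  unfolding invertibles_1_def by (rule connected_component_subset)

lemma tendsto_mult_inverse_one:
  fixes f g :: "'b \<Rightarrow> 'a::{real_normed_algebra, banach, comm_ring_1}"
  assumes f: "(f \<longlongrightarrow> 1) F" and inv: "\<forall>\<^sub>F t in F. f t * g t = 1"
  shows "(g \<longlongrightarrow> 1) F"
proof -
  have close: "\<forall>\<^sub>F t in F. norm (f t - 1) < 1/2"
    using tendstoD[OF f, of "1/2"] by (simp add: dist_norm)
  have "\<forall>\<^sub>F t in F. norm (g t - 1) \<le> norm (f t - 1) * (2 * norm (1::'a))"
    using close inv
  proof eventually_elim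
    case (elim t)
    have eq: "g t - 1 = - ((f t - 1) * g t)"
      using elim by (simp add: algebra_simps)
    then have le: "norm (g t - 1) \<le> norm (f t - 1) * norm (g t)"
      using norm_mult_ineq by simp
    also have "\<dots> \<le> 1/2 * norm (g t)"
      using elim by (intro mult_right_mono) auto
    finally have "norm (g t) \<le> 2 * norm (1::'a)"
      using norm_triangle_sub[of "g t" 1] by simp
    with le show ?case
      by (meson mult_left_mono norm_ge_zero order_trans)
  qed
  moreover have "((\<lambda>t. norm (f t - 1) * (2 * norm (1::'a))) \<longlongrightarrow> 0) F"
    by (rule tendsto_eq_intros f refl)+ simp
  ultimately have "((\<lambda>t. g t - 1) \<longlongrightarrow> 0) F"
    by (rule Lim_null_comparison)
  then show ?thesis by (simp add: LIM_zero_iff)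
qed

locale differentiable_golab_schinzel =
  fixes S \<gamma> :: "'a::{real_normed_algebra, banach, comm_ring_1} \<Rightarrow> 'a"
  assumes zero: "0 \<in> G_star S"
    and GS: "golab_schinzel S"
    and diff: "\<And>x. x \<in> G_one S \<Longrightarrow> S differentiable (at x)"
    and deriv0: "(S has_derivative \<gamma>) (at 0)"
begin

sublocale \<gamma>: bounded_linear \<gamma>
  using deriv0 by (rule has_derivative_bounded_linear)

definition I :: "'a set"
  where "I = {a. \<forall>h. \<gamma> (h * a) = 0}"

lemma I_mult: "a \<in> I \<Longrightarrow> b * a \<in> I"
  unfolding I_def by (simp add: mult.assoc[symmetric])

lemma I_add: "a \<in> I \<Longrightarrow> b \<in> I \<Longrightarrow> a + b \<in> I"
  unfolding I_def by (simp add: distrib_left \<gamma>.add)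

lemma I_diff: "a \<in> I \<Longrightarrow> b \<in> I \<Longrightarrow> a - b \<in> I"
  unfolding I_def by (simp add: right_diff_distrib \<gamma>.diff)

lemma I_scaleR_iff: "c \<noteq> 0 \<Longrightarrow> c *\<^sub>R a \<in> I \<longleftrightarrow> a \<in> I"
  unfolding I_def by (simp add: \<gamma>.scaleR)

lemma \<gamma>_I: "a \<in> I \<Longrightarrow> \<gamma> (h * a) = 0"
  unfolding I_def by simp

lemma equation: "x \<in> G_star S \<Longrightarrow> y \<in> G_star S \<Longrightarrow> S (x + S x * y) = S x * S y"
  using GS by (simp add: golab_schinzel_def)

lemma S_0 [simp]: "S 0 = 1"
proof -
  obtain k where k: "1 = S 0 * k"
    using zero by (auto simp: G_star_def invertibles_def elim: dvdE)
  have "S 0 = S 0 * S 0" using equation[OF zero zero] by simp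
  then have "S 0 * k = S 0 * (S 0 * k)" by (simp add: mult.assoc[symmetric])
  with k show ?thesis by simp
qed

lemma G_one_subset: "G_one S \<subseteq> G_star S"
  using invertibles_1_subset by (auto simp: G_one_def G_star_def)

lemma G_oneE:
  assumes "y \<in> G_one S"
  obtains v where "S y * v = 1"
proof -
  have "S y dvd 1"
    using assms G_one_subset by (auto simp: G_star_def invertibles_def)
  then show ?thesis using that by (metis dvdE)
qed

lemma S_tendsto: "(S \<longlongrightarrow> 1) (nhds 0)"
  using has_derivative_continuous[OF deriv0] tendsto_at_iff_tendsto_nhds[of S 0]
  by (simp add: continuous_within)

lemma eventually_G_one: "\<forall>\<^sub>F x in nhds 0. x \<in> G_one S"
  using topological_tendstoD[OF S_tendsto open_ball, of 1 1]
  by (auto simp: G_one_def intro: subsetD[OF ball_subset_invertibles_1] elim!: eventually_mono)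

lemma eventually_G_star: "\<forall>\<^sub>F x in nhds 0. x \<in> G_star S"
  using eventually_G_one by (rule eventually_mono) (use G_one_subset in blast)

lemma derivative_identity:
  assumes y: "y \<in> G_one S" and v: "S y * v = 1"
  shows "\<gamma> (v * (h + \<gamma> h * y)) = \<gamma> h"
proof -
  obtain D where D: "(S has_derivative D) (at y)"
    using diff[OF y] by (auto simp: differentiable_def)
  have y': "y \<in> G_star S" using y G_one_subset by blast
  have ev: "\<forall>\<^sub>F x in at 0. x \<in> G_star S"
    using eventually_G_star by (simp add: eventually_at_filter eventually_mono)
  have "((\<lambda>z. S (y + S y * z)) has_derivative (\<lambda>z. D (S y * z))) (at 0)"
    by (rule has_derivative_compose[where g = S and g' = D])
      (auto intro!: derivative_eq_intros D)
  then have "((\<lambda>z. S y * S z) has_derivative (\<lambda>z. D (S y * z))) (at 0)"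
    by (rule has_derivative_transform_eventually)
      (use ev y' in \<open>auto elim!: eventually_mono simp: equation\<close>)
  moreover have "((\<lambda>z. S y * S z) has_derivative (\<lambda>z. S y * \<gamma> z)) (at 0)"
    by (intro has_derivative_mult_right deriv0)
  ultimately have "(\<lambda>z. D (S y * z)) = (\<lambda>z. S y * \<gamma> z)"
    by (rule has_derivative_unique)
  then have D1: "D (S y * z) = S y * \<gamma> z" for z by metis
  have "((\<lambda>x. S (x + S x * y)) has_derivative (\<lambda>x. D (x + \<gamma> x * y))) (at 0)"
    by (rule has_derivative_compose[where g = S and g' = D])
      (auto intro!: derivative_eq_intros D deriv0)
  then have "((\<lambda>x. S x * S y) has_derivative (\<lambda>x. D (x + \<gamma> x * y))) (at 0)"
    by (rule has_derivative_transform_eventually)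
      (use ev y' in \<open>auto elim!: eventually_mono simp: equation\<close>)
  moreover have "((\<lambda>x. S x * S y) has_derivative (\<lambda>x. \<gamma> x * S y)) (at 0)"
    by (intro has_derivative_mult_left deriv0)
  ultimately have "(\<lambda>x. D (x + \<gamma> x * y)) = (\<lambda>x. \<gamma> x * S y)"
    by (rule has_derivative_unique)
  then have "\<gamma> h * S y = D (h + \<gamma> h * y)" by metis
  also have "h + \<gamma> h * y = S y * (v * (h + \<gamma> h * y))"
    using v by (simp add: mult.assoc[symmetric])
  also have "D \<dots> = S y * \<gamma> (v * (h + \<gamma> h * y))" by (rule D1)
  finally have "v * (\<gamma> h * S y) = v * (S y * \<gamma> (v * (h + \<gamma> h * y)))" by simp
  then have "(S y * v) * \<gamma> h = (S y * v) * \<gamma> (v * (h + \<gamma> h * y))"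
    by (simp add: ac_simps)
  then show ?thesis using v by simp
qed

definition V :: "'a \<Rightarrow> 'a"
  where "V y = (SOME v. S y * v = 1)"

lemma V: "y \<in> G_one S \<Longrightarrow> S y * V y = 1"
  unfolding V_def by (metis (mono_tags, lifting) G_oneE someI)

lemma V_tendsto: "(V \<longlongrightarrow> 1) (nhds 0)"
  by (rule tendsto_mult_inverse_one[OF S_tendsto])
    (use eventually_G_one in \<open>auto elim!: eventually_mono simp: V\<close>)

lemma \<gamma>_symmetric: "\<gamma> (a * \<gamma> b) = \<gamma> (b * \<gamma> a)"
proof -
  have lim0: "((\<lambda>t::real. t *\<^sub>R b) \<longlongrightarrow> 0) (at 0)"
    by (rule tendsto_eq_intros refl)+ simp
  have V1: "((\<lambda>t. V (t *\<^sub>R b)) \<longlongrightarrow> 1) (at (0::real))"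
    by (rule filterlim_compose[OF V_tendsto lim0])
  have G: "\<forall>\<^sub>F t in at (0::real). t *\<^sub>R b \<in> G_one S"
    using eventually_compose_filterlim[OF eventually_G_one lim0] .
  have "((\<lambda>t. S (t *\<^sub>R b)) has_derivative (\<lambda>t. \<gamma> (t *\<^sub>R b))) (at (0::real))"
    by (rule has_derivative_compose[where g = S and g' = \<gamma>])
      (auto intro!: derivative_eq_intros deriv0)
  then have "((\<lambda>t. norm (S (t *\<^sub>R b) - 1 - t *\<^sub>R \<gamma> b) / norm t) \<longlongrightarrow> 0) (at (0::real))"
    by (simp add: has_derivative_at \<gamma>.scaleR)
  moreover have "\<forall>\<^sub>F t in at (0::real). norm (S (t *\<^sub>R b) - 1 - t *\<^sub>R \<gamma> b) / norm t
      = norm ((1/t) *\<^sub>R (S (t *\<^sub>R b) - 1) - \<gamma> b)"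
    using eventually_neq_at_within[of 0]
  proof eventually_elim
    case (elim t)
    then have "(1/t) *\<^sub>R (S (t *\<^sub>R b) - 1) - \<gamma> b = (1/t) *\<^sub>R (S (t *\<^sub>R b) - 1 - t *\<^sub>R \<gamma> b)"
      by (simp add: scaleR_diff_right)
    then show ?case by simp
  qed
  ultimately have "((\<lambda>t. norm ((1/t) *\<^sub>R (S (t *\<^sub>R b) - 1) - \<gamma> b)) \<longlongrightarrow> 0) (at (0::real))"
    by (rule Lim_transform_eventually)
  then have S1: "((\<lambda>t. (1/t) *\<^sub>R (S (t *\<^sub>R b) - 1)) \<longlongrightarrow> \<gamma> b) (at (0::real))"
    by (rule LIM_zero_cancel[OF tendsto_norm_zero_cancel])
  have "((\<lambda>t. \<gamma> (V (t *\<^sub>R b) * (\<gamma> a * b - (1/t) *\<^sub>R (S (t *\<^sub>R b) - 1) * a)))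
      \<longlongrightarrow> \<gamma> (1 * (\<gamma> a * b - \<gamma> b * a))) (at 0)"
    by (intro \<gamma>.tendsto tendsto_intros V1 S1)
  moreover have "\<forall>\<^sub>F t in at 0. \<gamma> (V (t *\<^sub>R b) * (\<gamma> a * b - (1/t) *\<^sub>R (S (t *\<^sub>R b) - 1) * a)) = 0"
    using G eventually_neq_at_within[of 0]
  proof eventually_elim
    case (elim t)
    let ?v = "V (t *\<^sub>R b)" and ?u = "S (t *\<^sub>R b)"
    have uv: "?u * ?v = 1" by (rule V[OF elim(1)])
    have "t *\<^sub>R (?v * (\<gamma> a * b - (1/t) *\<^sub>R (?u - 1) * a)) = ?v * (a + \<gamma> a * (t *\<^sub>R b)) - (?u * ?v) * a"
      using elim(2) by (simp add: algebra_simps)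
    from arg_cong[OF this, of \<gamma>]
    have "t *\<^sub>R \<gamma> (?v * (\<gamma> a * b - (1/t) *\<^sub>R (?u - 1) * a)) = 0"
      unfolding \<gamma>.scaleR \<gamma>.diff uv mult_1 derivative_identity[OF elim(1) uv] diff_self .
    then show ?case using elim(2) by simp
  qed
  ultimately have "((\<lambda>t::real. 0) \<longlongrightarrow> \<gamma> (1 * (\<gamma> a * b - \<gamma> b * a))) (at 0)"
    by (rule Lim_transform_eventually)
  then have "\<gamma> (1 * (\<gamma> a * b - \<gamma> b * a)) = 0"
    by (rule LIM_const_eq[symmetric])
  then show ?thesis by (simp add: \<gamma>.diff mult.commute)
qed

lemma inverse_mod_I:
  assumes y: "y \<in> G_one S" and v: "S y * v = 1"
  shows "v - 1 + \<gamma> (y * v) \<in> I"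
proof -
  have "\<gamma> (h * (v - 1 + \<gamma> (y * v))) = 0" for h
    using derivative_identity[OF y v, of h] \<gamma>_symmetric[of h "y * v"]
    by (simp add: algebra_simps \<gamma>.add \<gamma>.diff)
  then show ?thesis by (simp add: I_def)
qed

lemma eventually_S_mod_I: "\<forall>\<^sub>F y in nhds 0. S y - 1 - \<gamma> y \<in> I"
proof -
  have "((\<lambda>y. - (y * V y)) \<longlongrightarrow> - (0 * 1)) (nhds 0)"
    by (intro tendsto_intros V_tendsto filterlim_ident)
  then have lim: "((\<lambda>y. - (y * V y)) \<longlongrightarrow> 0) (nhds 0)" by simp
  show ?thesis
    using eventually_G_one eventually_compose_filterlim[OF eventually_G_one lim]
  proof eventually_elim
    case (elim y)
    let ?w = "- (y * V y)"
    have v: "S y * V y = 1" using V elim by simp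
    have "S y * ?w = - (y * (S y * V y))" by (simp add: algebra_simps)
    then have w: "y + S y * ?w = 0" using v by simp
    have "S y * S ?w = S (y + S y * ?w)"
      by (rule equation[symmetric]) (use elim G_one_subset in auto)
    then have "S ?w * S y = 1" unfolding w by (simp add: mult.commute)
    from inverse_mod_I[OF elim(2) this]
    show ?case using v by (simp add: mult.assoc mult.commute[of "V y"] \<gamma>.neg)
  qed
qed

lemma \<gamma>_\<gamma>_mult_mod_I: "\<gamma> (\<gamma> x * z) - \<gamma> x * \<gamma> z \<in> I"
proof -
  define P where "P y \<longleftrightarrow> y \<in> G_star S \<and> S y - 1 - \<gamma> y \<in> I" for y
  have "\<forall>\<^sub>F y in nhds 0. P y"
    unfolding P_def by (intro eventually_conj eventually_G_star eventually_S_mod_I)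
  then obtain U where U: "open U" "0 \<in> U" and PU: "\<And>y. y \<in> U \<Longrightarrow> P y"
    unfolding eventually_nhds by blast
  have small: "\<exists>t::real. t \<noteq> 0 \<and> t *\<^sub>R z \<in> U \<and> x + a * (t *\<^sub>R z) \<in> U" if "x \<in> U" for a x z
  proof -
    have "((\<lambda>t::real. t *\<^sub>R z) \<longlongrightarrow> 0) (at 0)" "((\<lambda>t::real. x + a * (t *\<^sub>R z)) \<longlongrightarrow> x) (at 0)"
      by (rule tendsto_eq_intros refl | simp)+
    from topological_tendstoD[OF this(1) U] topological_tendstoD[OF this(2) U(1) that]
    have "\<forall>\<^sub>F t in at (0::real). t \<noteq> 0 \<and> t *\<^sub>R z \<in> U \<and> x + a * (t *\<^sub>R z) \<in> U"
      by (intro eventually_conj eventually_neq_at_within)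
    then show ?thesis using eventually_happens'[OF at_neq_bot] by blast
  qed
  have local: "\<gamma> (\<gamma> x * z) - \<gamma> x * \<gamma> z \<in> I" if x: "x \<in> U" for x
  proof -
    obtain t :: real where t: "t \<noteq> 0" "t *\<^sub>R z \<in> U" "x + S x * (t *\<^sub>R z) \<in> U"
      using small[OF x] by blast
    let ?y = "t *\<^sub>R z" and ?i = "S x - 1 - \<gamma> x"
    have "S (x + S x * ?y) = S x * S ?y"
      by (rule equation) (use PU[OF x] PU[OF t(2)] in \<open>auto simp: P_def\<close>)
    then have 1: "S x * S ?y - 1 - \<gamma> (x + S x * ?y) \<in> I"
      using PU[OF t(3)] by (simp add: P_def)
    have 2: "?i \<in> I" and 3: "S ?y - 1 - \<gamma> ?y \<in> I"
      using PU[OF x] PU[OF t(2)] by (auto simp: P_def)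
    have "\<gamma> (?y * ?i) = 0" using 2 by (rule \<gamma>_I)
    then have 4: "\<gamma> (S x * ?y) = \<gamma> ?y + \<gamma> (\<gamma> x * ?y)"
      by (simp add: algebra_simps \<gamma>.diff \<gamma>.add)
    have "(S x * (S ?y - 1 - \<gamma> ?y) + (\<gamma> ?y * ?i + ?i)) - (S x * S ?y - 1 - \<gamma> (x + S x * ?y)) \<in> I"
      by (intro I_diff I_add I_mult 1 2 3)
    also have "(S x * (S ?y - 1 - \<gamma> ?y) + (\<gamma> ?y * ?i + ?i)) - (S x * S ?y - 1 - \<gamma> (x + S x * ?y))
        = \<gamma> (\<gamma> x * ?y) - \<gamma> x * \<gamma> ?y"
      unfolding \<gamma>.add 4 by (simp add: algebra_simps)
    also have "\<dots> = t *\<^sub>R (\<gamma> (\<gamma> x * z) - \<gamma> x * \<gamma> z)"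
      by (simp add: \<gamma>.scaleR algebra_simps)
    finally show ?thesis using t by (simp add: I_scaleR_iff)
  qed
  obtain t :: real where t: "t \<noteq> 0" "t *\<^sub>R x \<in> U"
    using small[OF U(2), where a = 0] by blast
  have "t *\<^sub>R (\<gamma> (\<gamma> x * z) - \<gamma> x * \<gamma> z) \<in> I"
    using local[OF t(2)] by (simp add: \<gamma>.scaleR algebra_simps)
  then show ?thesis using t by (simp add: I_scaleR_iff)
qed

lemma S_mod_I:
  assumes x: "x \<in> G_one S"
  shows "S x - 1 - \<gamma> x \<in> I"
proof -
  obtain v where v: "S x * v = 1" using x by (rule G_oneE)
  let ?i = "v - 1 + \<gamma> (x * v)"
  have i: "?i \<in> I" using inverse_mod_I[OF x v] .
  then have "\<gamma> (x * ?i) = 0" by (rule \<gamma>_I)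
  then have eq: "\<gamma> (\<gamma> (x * v) * x) = \<gamma> x - \<gamma> (x * v)"
    by (simp add: algebra_simps \<gamma>.diff \<gamma>.add)
  let ?j = "\<gamma> (\<gamma> (x * v) * x) - \<gamma> (x * v) * \<gamma> x"
  have "- S x * (?i + \<gamma> x * ?i + ?j) \<in> I"
    by (intro I_mult I_add i \<gamma>_\<gamma>_mult_mod_I)
  also have "?i + \<gamma> x * ?i + ?j = v + v * \<gamma> x - 1"
    unfolding eq by (simp add: algebra_simps)
  also have "- S x * \<dots> = S x - S x * v - S x * v * \<gamma> x"
    by (simp add: algebra_simps)
  finally show ?thesis using v by simp
qed

lemma \<gamma>_image_orthogonal: "\<gamma> a = 0 \<Longrightarrow> \<gamma> (a * \<gamma> b) = 0"
  using \<gamma>_symmetric[of a b] by simp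

end

theorem theorem2p1:
  fixes S \<gamma> :: "'a::{real_normed_algebra, banach, comm_ring_1} \<Rightarrow> 'a"
  assumes zero: "0 \<in> G_star S"
    and one: "1 \<in> G_star S"
    and cont: "continuous_on UNIV S"
    and GS: "golab_schinzel S"
    and diff: "\<And>x. x \<in> G_one S \<Longrightarrow> S differentiable (at x)"
    and deriv0: "(S has_derivative \<gamma>) (at 0)"
  shows "(\<exists>m n. m \<in> G_one S \<rightarrow> null_space \<gamma> \<and> n \<in> G_one S \<rightarrow> null_space \<gamma> \<and>
            (\<forall>x\<in>G_one S. S x = 1 + \<gamma> x + n x \<and> S x = 1 + \<gamma> 1 * x + m x) \<and>
            (\<forall>x\<in>G_one S. form_orthogonal \<gamma> (n x) (\<gamma> x) \<and> gform_orthogonal \<gamma> (n x) (\<gamma> x)) \<and>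
            (\<lambda>x. norm (n x)) \<in> o[at 0 within G_one S](\<lambda>x. norm x) \<and>
            (\<forall>x\<in>G_one S. form_orthogonal \<gamma> (m x) (\<gamma> x) \<and> gform_orthogonal \<gamma> (m x) (\<gamma> x) \<and>
               gform_orthogonal \<gamma> (m x) (\<gamma> 1 * x)))
         \<and> S ` one_set S \<subseteq> {y. \<gamma> (y - 1) = 0}
         \<and> {y. \<gamma> (y - 1) = 0} = (\<lambda>z. 1 + z) ` null_space \<gamma>
         \<and> (inj \<gamma> \<longrightarrow> (\<forall>x\<in>G_one S. S x = 1 + \<gamma> 1 * x))"
proof -
  interpret differentiable_golab_schinzel S \<gamma>
    using zero GS diff deriv0 by unfold_locales
  define n where "n = (\<lambda>x. S x - 1 - \<gamma> x)"
  define m where "m = (\<lambda>x. S x - 1 - \<gamma> 1 * x)"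
  have n0: "\<gamma> (n x) = 0" if "x \<in> G_one S" for x
    using \<gamma>_I[OF S_mod_I[OF that], of 1] by (simp add: n_def)
  have "\<gamma> (\<gamma> 1 * x) = \<gamma> (\<gamma> x)" for x
    using \<gamma>_symmetric[of x 1] by (simp add: mult.commute)
  then have m0: "\<gamma> (m x) = 0" if "x \<in> G_one S" for x
    using n0[OF that] by (simp add: m_def n_def \<gamma>.diff)
  have "((\<lambda>x. norm (n x) / norm x) \<longlongrightarrow> 0) (at 0)"
    using deriv0 by (simp add: has_derivative_at n_def)
  then have "((\<lambda>x. norm (n x) / norm x) \<longlongrightarrow> 0) (at 0 within G_one S)"
    by (rule tendsto_within_subset) simp
  then have n_small: "(\<lambda>x. norm (n x)) \<in> o[at 0 within G_one S](\<lambda>x. norm x)"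
    by (rule smalloI_tendsto) (simp add: eventually_at_filter)
  have shift: "{y. \<gamma> (y - 1) = 0} = (\<lambda>z. 1 + z) ` null_space \<gamma>"
  proof (intro equalityI subsetI)
    fix y assume "y \<in> {y. \<gamma> (y - 1) = 0}"
    then have "y - 1 \<in> null_space \<gamma>" by (simp add: null_space_def)
    then show "y \<in> (\<lambda>z. 1 + z) ` null_space \<gamma>" by (rule rev_image_eqI) simp
  qed (auto simp: null_space_def)
  have inj: "S x = 1 + \<gamma> 1 * x" if "inj \<gamma>" "x \<in> G_one S" for x
  proof -
    have "m x = 0"
      using that(1) by (rule injD) (simp add: m0[OF that(2)])
    then show ?thesis by (simp add: m_def algebra_simps)
  qed
  show ?thesis
  proof (intro conjI exI)
    show "m \<in> G_one S \<rightarrow> null_space \<gamma>" "n \<in> G_one S \<rightarrow> null_space \<gamma>"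
      using m0 n0 by (auto simp: null_space_def)
    show "\<forall>x\<in>G_one S. S x = 1 + \<gamma> x + n x \<and> S x = 1 + \<gamma> 1 * x + m x"
      by (simp add: m_def n_def)
    show "\<forall>x\<in>G_one S. form_orthogonal \<gamma> (n x) (\<gamma> x) \<and> gform_orthogonal \<gamma> (n x) (\<gamma> x)"
      using n0 by (simp add: form_orthogonal_def form_def gform_orthogonal_def gform_def
          \<gamma>_image_orthogonal)
    show "\<forall>x\<in>G_one S. form_orthogonal \<gamma> (m x) (\<gamma> x) \<and> gform_orthogonal \<gamma> (m x) (\<gamma> x) \<and>
        gform_orthogonal \<gamma> (m x) (\<gamma> 1 * x)"
      using m0 by (simp add: form_orthogonal_def form_def gform_orthogonal_def gform_def
          \<gamma>_image_orthogonal)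
    show "S ` one_set S \<subseteq> {y. \<gamma> (y - 1) = 0}"
      by (auto simp: one_set_def)
  qed (use n_small shift inj in auto)
qed

end
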